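(* Let $k\ge1$, let $\mu$ be a balanced pairwise independent distribution over $\{0,1\}^k$, and let $f:[0,1]^k\to[0,1]$ be the multilinear extension of a function $\{0,1\}^k\to[0,1]$. For every $\epsilon>0$ there are $d,\tau>0$ such that the following holds. There is a randomized test $\mathcal{A}$ which, given oracle access to any function $F:\{0,1\}^n\to[0,1]$ (for any $n$), satisfies: (1) $\mathcal{A}$ queries $F$ at $k$ points $x_1,\dots,x_k\in\{0,1\}^n$ and then accepts with probability $f(F(x_1),\dots,F(x_k))$; (2) if $F$ is a dictator then $\mathcal{A}$ accepts with probability at least $c_\mu(f)-\epsilon$; (3) if $F$ is $(d,\tau)$-quasirandom then $\mathcal{A}$ accepts with probability at most $s(f)+\epsilon$.
   Context: A distribution $\mu$ on $\{0,1\}^k$ is balanced pairwise independent if for all $i<j$ and $b_1,b_2\in\{0,1\}$, $\Pr_{x\sim\mu}[x_i=b_1\wedge x_j=b_2]=1/4$. Every $G:\{0,1\}^m\to\mathbb{R}$ is uniquely a multilinear polynomial $G(x)=\sum_{S\subseteq[m]}c_S x^S$ with $x^S=\prod_{i\in S}x_i$; this defines its multilinear extension to $[0,1]^m$. $F:\{0,1\}^n\to\mathbb{R}$ is a dictator if $F(x)=x_i$ for some $i\in[n]$. $F=\sum_S c_S x^S$ is $(d,\tau)$-quasirandom if for every $i\in[n]$, $\sum_{S\ni i,\,|S|\le d}c_S^2\le\tau$. For $f$ restricted to $\{0,1\}^k$: $c_\mu(f)=\mathbb{E}_{x\sim\mu}[f(x)]$, $s_p(f)=\mathbb{E}_{x\sim\{0,1\}^k_{(p)}}[f(x)]$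 with $\{0,1\}^k_{(p)}$ the $p$-biased product distribution, and $s(f)=\max_{p\in[0,1]}s_p(f)$.
   Formalization: In the definition of (d,τ)-quasirandom, c_S are the coefficients of F in the sign variables 1-2x_i (Fourier coefficients), not in the 0/1 monomials x^S; with the latter the claim is false, e.g. for 4-bit odd parity and F(x)=x_i if |x|>d, else 0. *)

theory Defs
  imports "HOL-Probability.Probability" "HOL-Probability.Product_PMF"
begin

type_synonym point = "nat \<Rightarrow> real"

definition cube :: "nat \<Rightarrow> point set" where
  "cube n = ({..<n} \<rightarrow>\<^sub>E {0, 1})"

definition solid_cube :: "nat \<Rightarrow> point set" where
  "solid_cube n = ({..<n} \<rightarrow>\<^sub>E {0..1})"

definition multilinear_poly :: "nat \<Rightarrow> (nat set \<Rightarrow> real) \<Rightarrow> point \<Rightarrow> real" where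
  "multilinear_poly n c x = (\<Sum>S\<in>Pow {..<n}. c S * (\<Prod>i\<in>S. x i))"

definition multilinear_extension :: "nat \<Rightarrow> (point \<Rightarrow> real) \<Rightarrow> (point \<Rightarrow> real) \<Rightarrow> bool" where
  "multilinear_extension n G f \<longleftrightarrow>
     (\<exists>c. \<forall>x\<in>solid_cube n. f x = multilinear_poly n c x) \<and> (\<forall>x\<in>cube n. f x = G x)"

definition balanced_pairwise_independent :: "nat \<Rightarrow> point pmf \<Rightarrow> bool" where
  "balanced_pairwise_independent k \<mu> \<longleftrightarrow>
     set_pmf \<mu> \<subseteq> cube k \<and>
     (\<forall>j<k. \<forall>i<j. \<forall>b\<^sub>1\<in>{0, 1}. \<forall>b\<^sub>2\<in>{0, 1}.
        measure_pmf.prob \<mu> {x. x i = b\<^sub>1 \<and> x j = b\<^sub>2} = 1 / 4)"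

definition dictator :: "nat \<Rightarrow> (point \<Rightarrow> real) \<Rightarrow> bool" where
  "dictator n F \<longleftrightarrow> (\<exists>i<n. \<forall>x\<in>cube n. F x = x i)"

text \<open>
  Quasirandomness refers to the coefficients of the multilinear expansion of \<open>F\<close> in the
  sign variables \<open>1 - 2 * x i = (-1) ^ x i\<close>, i.e. to the Fourier coefficients of \<open>F\<close>, which
  exist and are unique on \<open>Pow {..<n}\<close>. (The opposite sign convention gives the same squares.)
  The monomial coefficients in the 0/1 variables themselves must not be used here:
  those of degree at most \<open>d\<close> only see the inputs with at most \<open>d\<close> ones, so that, for instance,
  the function \<open>x i\<close> set to zero on these inputs would count as quasirandom.
\<close>

definition quasirandom :: "nat \<Rightarrow> nat \<Rightarrow> real \<Rightarrow> (point \<Rightarrow> real) \<Rightarrow> bool" where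
  "quasirandom n d \<tau> F \<longleftrightarrow>
     (\<exists>c. (\<forall>x\<in>cube n. F x = multilinear_poly n c (\<lambda>i. 1 - 2 * x i)) \<and>
          (\<forall>i<n. (\<Sum>S | S \<subseteq> {..<n} \<and> i \<in> S \<and> card S \<le> d. (c S)\<^sup>2) \<le> \<tau>))"

definition biased_cube_pmf :: "nat \<Rightarrow> real \<Rightarrow> point pmf" where
  "biased_cube_pmf k p = Pi_pmf {..<k} undefined (\<lambda>_. map_pmf of_bool (bernoulli_pmf p))"

definition c_val :: "point pmf \<Rightarrow> (point \<Rightarrow> real) \<Rightarrow> real" where
  "c_val \<mu> f = measure_pmf.expectation \<mu> f"

definition s_biased :: "nat \<Rightarrow> (point \<Rightarrow> real) \<Rightarrow> real \<Rightarrow> real" where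
  "s_biased k f p = measure_pmf.expectation (biased_cube_pmf k p) f"

definition s_val :: "nat \<Rightarrow> (point \<Rightarrow> real) \<Rightarrow> real" where
  "s_val k f = (SUP p\<in>{0..1}. s_biased k f p)"

text \<open>The supremum is a maximum.\<close>

lemma s_biased_eq_sum:
  assumes "p \<in> {0..1}"
  shows "s_biased k f p = (\<Sum>x\<in>cube k. f x * (\<Prod>i<k. if x i = 1 then p else 1 - p))"
proof -
  let ?b = "map_pmf of_bool (bernoulli_pmf p) :: real pmf"
  have b1: "pmf ?b 1 = p"
    using pmf_map_inj'[of "of_bool :: bool \<Rightarrow> real" "bernoulli_pmf p" True] assms
    by (simp add: inj_on_def)
  have b0: "pmf ?b 0 = 1 - p"
    using pmf_map_inj'[of "of_bool :: bool \<Rightarrow> real" "bernoulli_pmf p" False] assms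
    by (simp add: inj_on_def)
  have fin: "finite (cube k)"
    unfolding cube_def by (intro finite_PiE) auto
  have sub: "set_pmf (biased_cube_pmf k p) \<subseteq> cube k"
    unfolding biased_cube_pmf_def cube_def
    by (subst set_Pi_pmf) (auto simp: PiE_dflt_def PiE_def extensional_def)
  have "s_biased k f p = (\<Sum>x\<in>cube k. f x * pmf (biased_cube_pmf k p) x)"
    unfolding s_biased_def
    by (subst integral_measure_pmf_real[OF fin]) (use sub in \<open>auto simp: mult.commute\<close>)
  also have "\<dots> = (\<Sum>x\<in>cube k. f x * (\<Prod>i<k. if x i = 1 then p else 1 - p))"
  proof (rule sum.cong, simp)
    fix x assume x: "x \<in> cube k"
    have "pmf (biased_cube_pmf k p) x = (\<Prod>i<k. pmf ?b (x i))"
      unfolding biased_cube_pmf_def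
      using x by (subst pmf_Pi') (auto simp: cube_def PiE_def extensional_def)
    also have "\<dots> = (\<Prod>i<k. if x i = 1 then p else 1 - p)"
    proof (rule prod.cong, simp)
      fix i assume "i \<in> {..<k}"
      then have "x i \<in> {0, 1}" using x by (auto simp: cube_def)
      then show "pmf ?b (x i) = (if x i = 1 then p else 1 - p)" using b0 b1 by auto
    qed
    finally show "f x * pmf (biased_cube_pmf k p) x =
        f x * (\<Prod>i<k. if x i = 1 then p else 1 - p)" by simp
  qed
  finally show ?thesis .
qed

lemma s_val_is_max:
  obtains p where "p \<in> {0..1}" "s_val k f = s_biased k f p"
    "\<And>q. q \<in> {0..1} \<Longrightarrow> s_biased k f q \<le> s_val k f"
proof -
  have "continuous_on {0..1} (\<lambda>p. \<Sum>x\<in>cube k. f x * (\<Prod>i<k. if x i = 1 then p else 1 - p))"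
  proof (intro continuous_on_sum continuous_on_mult[OF continuous_on_const] continuous_on_prod)
    fix x :: point and i
    show "continuous_on {0..1} (\<lambda>p :: real. if x i = 1 then p else 1 - p)"
      by (cases "x i = 1") (auto intro!: continuous_intros)
  qed
  then have cont: "continuous_on {0..1} (s_biased k f)"
    by (rule continuous_on_eq) (simp add: s_biased_eq_sum)
  obtain p where p: "p \<in> {0..1}" "\<And>q. q \<in> {0..1} \<Longrightarrow> s_biased k f q \<le> s_biased k f p"
    using continuous_attains_sup[OF compact_Icc _ cont] by auto
  then have "s_val k f = s_biased k f p"
    unfolding s_val_def by (intro cSup_eq_maximum) auto
  with p show ?thesis using that by metis
qed

text \<open>
  A test maps an oracle to the distribution of its verdict (\<open>True\<close> is acceptance). It is
  determined by the joint distribution \<open>Q\<close> of its \<open>k\<close> query points, which does not depend on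
  the oracle.
\<close>

definition is_query_test ::
    "nat \<Rightarrow> (point \<Rightarrow> real) \<Rightarrow> nat \<Rightarrow> ((point \<Rightarrow> real) \<Rightarrow> bool pmf) \<Rightarrow> bool" where
  "is_query_test k f n A \<longleftrightarrow>
     (\<exists>Q :: (nat \<Rightarrow> point) pmf. set_pmf Q \<subseteq> ({..<k} \<rightarrow>\<^sub>E cube n) \<and>
        (\<forall>F \<in> cube n \<rightarrow> {0..1}.
           A F = bind_pmf Q (\<lambda>x. bernoulli_pmf (f (\<lambda>j\<in>{..<k}. F (x j))))))"

definition accept_prob :: "bool pmf \<Rightarrow> real" where
  "accept_prob V = pmf V True"

end

theory Submission
  imports Defs
begin

text \<open>
  The test draws \<open>n\<close> independent columns from \<open>\<mu>\<close> and rerandomizes every bit with probability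
  \<open>\<eta>\<close>. A dictator sees a column that is close to one from \<open>\<mu>\<close>, which gives completeness. Since
  \<open>f\<close> is multilinear, the acceptance probability is a combination of the expectations of
  \<open>\<Prod>j\<in>S. H (y j)\<close>, where \<open>y 0, \<dots>, y (k - 1)\<close> are the rows before rerandomization and
  \<open>H\<close> is the noise-smoothed \<open>F\<close>, which is still bounded and has total influence at most
  \<open>1 / \<eta>\<close> and, for quasirandom \<open>F\<close>, uniformly small influences.

  For \<open>k \<ge> 2\<close> these expectations are compared with powers of the mean of \<open>F\<close> by averaging out the
  coordinates one at a time. Writing \<open>H = A + z i * B\<close> in the sign variable \<open>z i\<close>, pairwise
  independence kills all terms with one or two factors \<open>B\<close>. In the others three factors can be
  bounded by \<open>E \<bar>B1 * B2 * B3\<bar> \<le> (E B\<^sup>2) powr (3 / 2)\<close>, by Cauchy-Schwarz and the independence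
  of any two rows; no invariance principle or hypercontractivity is needed. The errors add up to
  the total influence times the square root of the largest influence.
\<close>

subsection \<open>Expectations over finite products\<close>

lemma expectation_bind_finite:
  fixes h :: "'b \<Rightarrow> real"
  assumes "finite (set_pmf p)" and "\<And>x. x \<in> set_pmf p \<Longrightarrow> finite (set_pmf (q x))"
  shows "measure_pmf.expectation (bind_pmf p q) h =
    measure_pmf.expectation p (\<lambda>x. measure_pmf.expectation (q x) h)"
proof -
  have "measure_pmf.expectation (bind_pmf p q) h =
      (\<Sum>a\<in>set_pmf p. pmf p a *\<^sub>R measure_pmf.expectation (q a) h)"
    by (rule pmf_expectation_bind) (use assms in auto)
  also have "\<dots> = measure_pmf.expectation p (\<lambda>x. measure_pmf.expectation (q x) h)"
    by (subst integral_measure_pmf_real[OF assms(1)]) (auto simp: mult.commute)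
  finally show ?thesis .
qed

lemma expectation_cong:
  fixes g h :: "'a \<Rightarrow> real"
  assumes "\<And>x. x \<in> set_pmf p \<Longrightarrow> g x = h x"
  shows "measure_pmf.expectation p g = measure_pmf.expectation p h"
  using assms by (intro integral_cong_AE) (auto simp: AE_measure_pmf_iff)

lemma expectation_mono:
  fixes g h :: "'a \<Rightarrow> real"
  assumes "finite (set_pmf p)" and "\<And>x. x \<in> set_pmf p \<Longrightarrow> g x \<le> h x"
  shows "measure_pmf.expectation p g \<le> measure_pmf.expectation p h"
  using assms
  by (intro integral_mono_AE) (auto simp: AE_measure_pmf_iff integrable_measure_pmf_finite)

lemma expectation_mem_Icc:
  fixes h :: "'a \<Rightarrow> real"
  assumes "finite (set_pmf p)" and "\<And>x. x \<in> set_pmf p \<Longrightarrow> h x \<in> {a..b}"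
  shows "measure_pmf.expectation p h \<in> {a..b}"
  using expectation_mono[of p "\<lambda>_. a" h] expectation_mono[of p h "\<lambda>_. b"] assms by auto

lemma finite_set_Pi_pmf:
  assumes "finite I" and "\<And>i. i \<in> I \<Longrightarrow> finite (set_pmf (p i))"
  shows "finite (set_pmf (Pi_pmf I d p))"
  using assms by (subst set_Pi_pmf) auto

lemma expectation_Pi_pmf_insert:
  fixes h :: "('i \<Rightarrow> 'a) \<Rightarrow> real"
  assumes "finite I" and "i \<notin> I" and fin: "\<And>j. j \<in> insert i I \<Longrightarrow> finite (set_pmf (p j))"
  shows "measure_pmf.expectation (Pi_pmf (insert i I) d p) h =
    measure_pmf.expectation (p i) (\<lambda>x.
      measure_pmf.expectation (Pi_pmf I d p) (\<lambda>M. h (M(i := x))))"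
proof -
  have "finite (set_pmf (Pi_pmf I d p))"
    using assms by (intro finite_set_Pi_pmf) auto
  then show ?thesis
    using assms by (simp add: Pi_pmf_insert' expectation_bind_finite)
qed

subsection \<open>Multilinear polynomials\<close>

definition mlpoly :: "'i set \<Rightarrow> ('i set \<Rightarrow> real) \<Rightarrow> ('i \<Rightarrow> real) \<Rightarrow> real" where
  "mlpoly I c z = (\<Sum>S\<in>Pow I. c S * (\<Prod>i\<in>S. z i))"

lemma multilinear_poly_eq_mlpoly: "multilinear_poly n = mlpoly {..<n}"
  by (simp add: multilinear_poly_def mlpoly_def fun_eq_iff)

lemma mlpoly_cong:
  assumes "\<And>S. S \<subseteq> I \<Longrightarrow> c S = c' S" and "\<And>i. i \<in> I \<Longrightarrow> z i = z' i"
  shows "mlpoly I c z = mlpoly I c' z'"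
  unfolding mlpoly_def
  by (intro sum.cong arg_cong2[of _ _ _ _ "(*)"] prod.cong) (use assms in auto)

lemma sum_Pow_insert:
  fixes g :: "'i set \<Rightarrow> 'b :: comm_monoid_add"
  assumes "finite I" and "i \<notin> I"
  shows "(\<Sum>S\<in>Pow (insert i I). g S) = (\<Sum>S\<in>Pow I. g S) + (\<Sum>S\<in>Pow I. g (insert i S))"
proof -
  have "inj_on (insert i) (Pow I)"
    using assms(2) by (auto simp: inj_on_def)
  moreover have "Pow I \<inter> insert i ` Pow I = {}"
    using assms(2) by auto
  ultimately show ?thesis
    using assms(1) by (simp add: Pow_insert sum.union_disjoint sum.reindex)
qed

lemma mlpoly_insert:
  assumes "finite I" and "i \<notin> I"
  shows "mlpoly (insert i I) c z = mlpoly I c z + z i * mlpoly I (\<lambda>S. c (insert i S)) z"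
proof -
  have "(\<Prod>j\<in>insert i S. z j) = z i * (\<Prod>j\<in>S. z j)" if "S \<in> Pow I" for S
  proof (subst prod.insert)
    show "finite S" "i \<notin> S" using that assms finite_subset by auto
  qed simp
  then show ?thesis
    unfolding mlpoly_def using assms
    by (simp add: sum_Pow_insert sum_distrib_left mult.left_commute)
qed

lemma mlpoly_scale: "mlpoly I c (\<lambda>i. r * z i) = mlpoly I (\<lambda>S. r ^ card S * c S) z"
  by (simp add: mlpoly_def prod.distrib mult_ac)

lemma expectation_mlpoly:
  fixes g :: "'i \<Rightarrow> 'a \<Rightarrow> real"
  assumes "finite I" and "\<And>i. i \<in> I \<Longrightarrow> finite (set_pmf (p i))"
  shows "measure_pmf.expectation (Pi_pmf I d p) (\<lambda>x. mlpoly I c (\<lambda>i. g i (x i))) =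
    mlpoly I c (\<lambda>i. measure_pmf.expectation (p i) (g i))"
  using assms
proof (induction I arbitrary: c rule: finite_induct)
  case empty
  then show ?case by (simp add: mlpoly_def)
next
  case (insert i I)
  let ?P = "Pi_pmf I d p"
  have fin: "finite (set_pmf (p i))" "finite (set_pmf ?P)"
    using insert by (auto intro!: finite_set_Pi_pmf)
  have [simp]: "mlpoly I c' (\<lambda>j. g j (if j = i then y else x j)) = mlpoly I c' (\<lambda>j. g j (x j))"
    for c' x y
    by (rule mlpoly_cong) (use insert in auto)
  have IH: "measure_pmf.expectation ?P (\<lambda>x. mlpoly I c' (\<lambda>i. g i (x i))) =
      mlpoly I c' (\<lambda>i. measure_pmf.expectation (p i) (g i))" for c'
    using insert by auto
  have "measure_pmf.expectation (Pi_pmf (insert i I) d p)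
        (\<lambda>x. mlpoly (insert i I) c (\<lambda>i. g i (x i))) =
      measure_pmf.expectation (p i) (\<lambda>y. measure_pmf.expectation ?P
        (\<lambda>x. mlpoly (insert i I) c (\<lambda>j. g j ((x(i := y)) j))))"
    using insert.hyps insert.prems by (intro expectation_Pi_pmf_insert)
  then show ?case
    using fin by (simp add: mlpoly_insert[OF insert.hyps(1,2)] IH integrable_measure_pmf_finite)
qed

definition influence :: "'i set \<Rightarrow> ('i set \<Rightarrow> real) \<Rightarrow> 'i \<Rightarrow> real" where
  "influence I c i = (\<Sum>S | S \<subseteq> I \<and> i \<in> S. (c S)\<^sup>2)"

lemma influence_insert_self:
  assumes "i \<notin> I"
  shows "influence (insert i I) c i = (\<Sum>S\<in>Pow I. (c (insert i S))\<^sup>2)"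
proof -
  have "{S. S \<subseteq> insert i I \<and> i \<in> S} = insert i ` Pow I"
    using assms by (auto simp: image_iff intro!: bexI[of _ "_ - {i}"])
  moreover have "inj_on (insert i) (Pow I)"
    using assms by (auto simp: inj_on_def)
  ultimately show ?thesis by (simp add: influence_def sum.reindex)
qed

lemma influence_mono:
  assumes "finite K" and "I \<subseteq> K"
  shows "influence I c l \<le> influence K c l"
  unfolding influence_def using assms by (intro sum_mono2) auto

lemma prod_abs_le_three:
  fixes A B :: "'j \<Rightarrow> real"
  assumes A: "\<And>j. \<bar>A j\<bar> \<le> 1" and B: "\<And>j. \<bar>B j\<bar> \<le> 1"
    and "finite T" and "{a, b, e} \<subseteq> T" and "a \<noteq> b" "a \<noteq> e" "b \<noteq> e"
  shows "\<bar>(\<Prod>j\<in>K. A j) * (\<Prod>j\<in>T. B j)\<bar> \<le> \<bar>B a * B b * B e\<bar>"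
proof -
  have "(\<Prod>j\<in>T. B j) = (\<Prod>j\<in>T - {a, b, e}. B j) * (\<Prod>j\<in>{a, b, e}. B j)"
    using assms(3,4) by (intro prod.subset_diff)
  also have "(\<Prod>j\<in>{a, b, e}. B j) = B a * B b * B e"
    using assms(5-7) by simp
  finally have eq: "\<bar>(\<Prod>j\<in>K. A j) * (\<Prod>j\<in>T. B j)\<bar> =
      \<bar>\<Prod>j\<in>K. A j\<bar> * \<bar>\<Prod>j\<in>T - {a, b, e}. B j\<bar> * \<bar>B a * B b * B e\<bar>"
    by (simp add: abs_mult)
  have "\<bar>\<Prod>j\<in>K. A j\<bar> \<le> 1" "\<bar>\<Prod>j\<in>T - {a, b, e}. B j\<bar> \<le> 1"
    using A B by (auto simp: abs_prod intro!: prod_le_1)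
  then show ?thesis
    unfolding eq by (intro mult_left_le_one_le) (auto intro: mult_le_one)
qed

lemma obtain_three:
  assumes "finite T" and "T \<noteq> {}" and "card T \<noteq> 1" and "card T \<noteq> 2"
  obtains a b e where "{a, b, e} \<subseteq> T" "a \<noteq> b" "a \<noteq> e" "b \<noteq> e"
proof -
  have "card T \<noteq> 0"
    using assms(1,2) by simp
  then have "3 \<le> card T"
    using assms(3,4) by linarith
  then obtain U where U: "U \<subseteq> T" "card U = 3"
    using obtain_subset_with_card_n by metis
  from U(2) obtain a b e where "U = {a, b, e}" "a \<noteq> b" "a \<noteq> e" "b \<noteq> e"
    unfolding card_3_iff by (elim exE conjE)
  with U(1) show ?thesis
    by (intro that[of a b e]) simp_all
qed

subsection \<open>Pairwise independent sign columns\<close>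

locale pairwise_signs =
  fixes \<kappa> :: "'a pmf" and u :: "'j \<Rightarrow> 'a \<Rightarrow> real" and J :: "'j set"
  assumes finite_\<kappa>: "finite (set_pmf \<kappa>)"
    and finite_J: "finite J"
    and sign: "u j x = 1 \<or> u j x = - 1"
    and mean: "j \<in> J \<Longrightarrow> measure_pmf.expectation \<kappa> (u j) = 0"
    and uncorrelated: "j \<in> J \<Longrightarrow> l \<in> J \<Longrightarrow> j \<noteq> l \<Longrightarrow>
      measure_pmf.expectation \<kappa> (\<lambda>x. u j x * u l x) = 0"
begin

definition columns :: "'i set \<Rightarrow> ('i \<Rightarrow> 'a) pmf" where
  "columns I = Pi_pmf I undefined (\<lambda>_. \<kappa>)"

abbreviation row_poly :: "'i set \<Rightarrow> ('i set \<Rightarrow> real) \<Rightarrow> 'j \<Rightarrow> ('i \<Rightarrow> 'a) \<Rightarrow> real" where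
  "row_poly I c j M \<equiv> mlpoly I c (\<lambda>i. u j (M i))"

lemma u_square [simp]: "u j x * u j x = 1" "(u j x)\<^sup>2 = 1"
  using sign[of j x] by auto

lemma abs_u [simp]: "\<bar>u j x\<bar> = 1"
  using sign[of j x] by auto

lemma finite_columns [simp]: "finite I \<Longrightarrow> finite (set_pmf (columns I))"
  unfolding columns_def by (intro finite_set_Pi_pmf finite_\<kappa>)

lemma integrable_columns [simp]:
  fixes h :: "('i \<Rightarrow> 'a) \<Rightarrow> real"
  shows "finite I \<Longrightarrow> integrable (measure_pmf (columns I)) h"
  by (simp add: integrable_measure_pmf_finite)

lemma integrable_\<kappa> [simp]: "integrable (measure_pmf \<kappa>) (h :: 'a \<Rightarrow> real)"
  by (simp add: integrable_measure_pmf_finite finite_\<kappa>)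

lemma expectation_columns_insert:
  fixes h :: "('i \<Rightarrow> 'a) \<Rightarrow> real"
  assumes "finite I" and "i \<notin> I"
  shows "measure_pmf.expectation (columns (insert i I)) h =
    measure_pmf.expectation \<kappa> (\<lambda>x.
      measure_pmf.expectation (columns I) (\<lambda>M. h (M(i := x))))"
  unfolding columns_def using assms finite_\<kappa> by (simp add: expectation_Pi_pmf_insert)

lemma row_poly_upd:
  assumes "finite I" and "i \<notin> I"
  shows "row_poly (insert i I) c j (M(i := x)) =
    row_poly I c j M + u j x * row_poly I (\<lambda>S. c (insert i S)) j M"
proof -
  have "row_poly I c' j (M(i := x)) = row_poly I c' j M" for c'
    by (rule mlpoly_cong) (use assms in auto)
  then show ?thesis using assms by (simp add: mlpoly_insert)
qed

lemma expectation_row_poly_square: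
  assumes "finite I" and "j \<in> J"
  shows "measure_pmf.expectation (columns I) (\<lambda>M. (row_poly I c j M)\<^sup>2) = (\<Sum>S\<in>Pow I. (c S)\<^sup>2)"
  using assms(1)
proof (induction I arbitrary: c rule: finite_induct)
  case empty
  then show ?case by (simp add: mlpoly_def)
next
  case (insert i I)
  let ?A = "row_poly I c j" and ?B = "row_poly I (\<lambda>S. c (insert i S)) j"
  have "measure_pmf.expectation (columns (insert i I)) (\<lambda>M. (row_poly (insert i I) c j M)\<^sup>2) =
      measure_pmf.expectation \<kappa> (\<lambda>x. measure_pmf.expectation (columns I)
        (\<lambda>M. (?A M)\<^sup>2 + (?B M)\<^sup>2 + u j x * (2 * ?A M * ?B M)))"
    by (simp only: expectation_columns_insert[OF insert.hyps(1,2)] row_poly_upd[OF insert.hyps(1,2)])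
      (simp add: power2_sum power_mult_distrib algebra_simps)
  also have "\<dots> = (\<Sum>S\<in>Pow I. (c S)\<^sup>2) + (\<Sum>S\<in>Pow I. (c (insert i S))\<^sup>2)"
    using insert.hyps by (simp add: insert.IH mean[OF assms(2)])
  finally show ?case using insert.hyps by (simp add: sum_Pow_insert)
qed

lemma expectation_row_poly_square_mult:
  assumes "finite I" and "j \<in> J" and "l \<in> J" and "j \<noteq> l"
  shows "measure_pmf.expectation (columns I) (\<lambda>M. (row_poly I c j M)\<^sup>2 * (row_poly I e l M)\<^sup>2) =
    (\<Sum>S\<in>Pow I. (c S)\<^sup>2) * (\<Sum>S\<in>Pow I. (e S)\<^sup>2)"
  using assms(1)
proof (induction I arbitrary: c e rule: finite_induct)
  case empty
  then show ?case by (simp add: mlpoly_def)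
next
  case (insert i I)
  let ?A = "row_poly I c j" and ?B = "row_poly I (\<lambda>S. c (insert i S)) j"
  let ?C = "row_poly I e l" and ?D = "row_poly I (\<lambda>S. e (insert i S)) l"
  let ?E = "measure_pmf.expectation (columns I)"
  have expand: "(a + s * b)\<^sup>2 * (c + t * d)\<^sup>2 =
      a\<^sup>2 * c\<^sup>2 + a\<^sup>2 * d\<^sup>2 + b\<^sup>2 * c\<^sup>2 + b\<^sup>2 * d\<^sup>2
      + s * (2 * a * b * (c\<^sup>2 + d\<^sup>2)) + t * (2 * c * d * (a\<^sup>2 + b\<^sup>2))
      + (s * t) * (4 * a * b * c * d)"
    if "s\<^sup>2 = 1" "t\<^sup>2 = 1" for a b c d s t :: real
  proof -
    have "(a + s * b)\<^sup>2 = a\<^sup>2 + b\<^sup>2 + s * (2 * a * b)" "(c + t * d)\<^sup>2 = c\<^sup>2 + d\<^sup>2 + t * (2 * c * d)"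
      using that by (simp_all add: power2_sum power_mult_distrib)
    then show ?thesis by (simp add: algebra_simps)
  qed
  have "measure_pmf.expectation (columns (insert i I))
        (\<lambda>M. (row_poly (insert i I) c j M)\<^sup>2 * (row_poly (insert i I) e l M)\<^sup>2) =
      measure_pmf.expectation \<kappa> (\<lambda>x.
        ?E (\<lambda>M. (?A M)\<^sup>2 * (?C M)\<^sup>2) + ?E (\<lambda>M. (?A M)\<^sup>2 * (?D M)\<^sup>2)
        + ?E (\<lambda>M. (?B M)\<^sup>2 * (?C M)\<^sup>2) + ?E (\<lambda>M. (?B M)\<^sup>2 * (?D M)\<^sup>2)
        + u j x * ?E (\<lambda>M. 2 * ?A M * ?B M * ((?C M)\<^sup>2 + (?D M)\<^sup>2))
        + u l x * ?E (\<lambda>M. 2 * ?C M * ?D M * ((?A M)\<^sup>2 + (?B M)\<^sup>2))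
        + (u j x * u l x) * ?E (\<lambda>M. 4 * ?A M * ?B M * ?C M * ?D M))"
    using insert.hyps
    by (simp only: expectation_columns_insert[OF insert.hyps(1,2)]
        row_poly_upd[OF insert.hyps(1,2)] expand u_square)
      (simp only: Bochner_Integration.integral_add integrable_columns integral_mult_right_zero)
  also have "\<dots> = ((\<Sum>S\<in>Pow I. (c S)\<^sup>2) + (\<Sum>S\<in>Pow I. (c (insert i S))\<^sup>2)) *
      ((\<Sum>S\<in>Pow I. (e S)\<^sup>2) + (\<Sum>S\<in>Pow I. (e (insert i S))\<^sup>2))"
    by (simp add: insert.IH mean assms uncorrelated) (simp add: algebra_simps)
  finally show ?case using insert.hyps by (simp add: sum_Pow_insert)
qed

lemma expectation_row_poly_triple:
  assumes "finite I" and "a \<in> J" and "b \<in> J" and "e \<in> J" and "a \<noteq> b"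
    and V: "(\<Sum>S\<in>Pow I. (c S)\<^sup>2) \<le> \<theta>" and "\<theta> > 0"
  shows "measure_pmf.expectation (columns I)
      (\<lambda>M. \<bar>row_poly I c a M * row_poly I c b M * row_poly I c e M\<bar>)
    \<le> sqrt \<theta> * (\<Sum>S\<in>Pow I. (c S)\<^sup>2)"
proof -
  define V where "V = (\<Sum>S\<in>Pow I. (c S)\<^sup>2)"
  define s where "s = sqrt \<theta>"
  have s: "s > 0" "V \<le> s * s" "V \<ge> 0"
    using assms by (auto simp: s_def V_def intro: sum_nonneg)
  have amgm: "\<bar>x * y * z\<bar> \<le> (1 / (2 * s)) * (x\<^sup>2 * y\<^sup>2) + (s / 2) * z\<^sup>2" for x y z :: real
  proof -
    have "0 \<le> (\<bar>x * y\<bar> - s * \<bar>z\<bar>)\<^sup>2 / (2 * s)"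
      using s by simp
    also have "\<dots> = (1 / (2 * s)) * (x\<^sup>2 * y\<^sup>2) + (s / 2) * z\<^sup>2 - \<bar>x * y * z\<bar>"
      using s by (simp add: power2_diff power_mult_distrib abs_mult field_simps power2_eq_square)
    finally show ?thesis by simp
  qed
  have "measure_pmf.expectation (columns I)
      (\<lambda>M. \<bar>row_poly I c a M * row_poly I c b M * row_poly I c e M\<bar>)
    \<le> measure_pmf.expectation (columns I) (\<lambda>M.
      (1 / (2 * s)) * ((row_poly I c a M)\<^sup>2 * (row_poly I c b M)\<^sup>2) + (s / 2) * (row_poly I c e M)\<^sup>2)"
    using assms by (intro expectation_mono amgm) auto
  also have "\<dots> = (1 / (2 * s)) * (V * V) + (s / 2) * V"
    using assms expectation_row_poly_square_mult[of I a b c c] expectation_row_poly_square[of I e c]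
    by (simp add: V_def)
  also have "\<dots> \<le> (1 / (2 * s)) * (V * (s * s)) + (s / 2) * V"
    using s by (intro add_right_mono mult_left_mono) auto
  also have "\<dots> = s * V"
    using s by (simp add: field_simps)
  finally show ?thesis by (simp add: s_def V_def)
qed

text \<open>
  One replacement step: averaging out the column \<open>i\<close> only leaves products of at least three of
  the sign variables, because those of one or two have mean zero.
\<close>

lemma replace_column:
  assumes "finite I" and "i \<notin> I"
    and A: "\<And>j M. \<bar>row_poly I c j M\<bar> \<le> 1"
    and B: "\<And>j M. \<bar>row_poly I (\<lambda>S. c (insert i S)) j M\<bar> \<le> 1"
    and "influence (insert i I) c i \<le> \<theta>" and "\<theta> > 0"
  shows "\<bar>measure_pmf.expectation (columns (insert i I)) (\<lambda>M. \<Prod>j\<in>J. row_poly (insert i I) c j M) -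
      measure_pmf.expectation (columns I) (\<lambda>M. \<Prod>j\<in>J. row_poly I c j M)\<bar>
    \<le> 2 ^ card J * (sqrt \<theta> * influence (insert i I) c i)"
proof -
  let ?A = "row_poly I c" and ?B = "row_poly I (\<lambda>S. c (insert i S))"
  let ?E = "measure_pmf.expectation (columns I)" and ?v = "influence (insert i I) c i"
  define t where "t T = measure_pmf.expectation \<kappa> (\<lambda>x. \<Prod>j\<in>T. u j x) *
    ?E (\<lambda>M. (\<Prod>j\<in>J - T. ?A j M) * (\<Prod>j\<in>T. ?B j M))" for T
  have expand: "(\<Prod>j\<in>J. ?A j M + u j x * ?B j M) =
      (\<Sum>T\<in>Pow J. (\<Prod>j\<in>T. u j x) * ((\<Prod>j\<in>J - T. ?A j M) * (\<Prod>j\<in>T. ?B j M)))" for M x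
    using prod_add[OF finite_J, of "\<lambda>j. u j x * ?B j M" "\<lambda>j. ?A j M"]
    by (simp add: add.commute prod.distrib mult_ac)
  have "measure_pmf.expectation (columns (insert i I)) (\<lambda>M. \<Prod>j\<in>J. row_poly (insert i I) c j M) =
      (\<Sum>T\<in>Pow J. t T)"
    unfolding expectation_columns_insert[OF assms(1,2)] row_poly_upd[OF assms(1,2)] expand t_def
    using assms(1) by (simp add: Bochner_Integration.integral_sum)
  also have "\<dots> = t {} + (\<Sum>T\<in>Pow J - {{}}. t T)"
    using finite_J by (intro sum.remove) auto
  also have "t {} = ?E (\<lambda>M. \<Prod>j\<in>J. ?A j M)"
    by (simp add: t_def)
  finally have diff: "measure_pmf.expectation (columns (insert i I))
        (\<lambda>M. \<Prod>j\<in>J. row_poly (insert i I) c j M) - ?E (\<lambda>M. \<Prod>j\<in>J. ?A j M) =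
      (\<Sum>T\<in>Pow J - {{}}. t T)"
    by simp
  have v: "?v \<ge> 0"
    by (auto simp: influence_def intro: sum_nonneg)
  have bound: "\<bar>t T\<bar> \<le> sqrt \<theta> * ?v" if T: "T \<in> Pow J - {{}}" for T
  proof -
    have "finite T"
      using T finite_J finite_subset by auto
    consider "card T = 1" | "card T = 2" | "card T \<noteq> 1" "card T \<noteq> 2" by blast
    then show ?thesis
    proof cases
      case 1
      then obtain j where "T = {j}" by (auto simp: card_1_singleton_iff)
      then have "t T = 0" using T by (simp add: t_def mean)
      then show ?thesis using v assms by simp
    next
      case 2
      then obtain j l where "T = {j, l}" "j \<noteq> l" by (auto simp: card_2_iff)
      then have "t T = 0" using T by (simp add: t_def uncorrelated)
      then show ?thesis using v assms by simp
    next
      case 3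
      then obtain a b e where abe: "{a, b, e} \<subseteq> T" "a \<noteq> b" "a \<noteq> e" "b \<noteq> e"
        using obtain_three[OF \<open>finite T\<close>] T by blast
      have "\<bar>t T\<bar> \<le> 1 * ?E (\<lambda>M. \<bar>?B a M * ?B b M * ?B e M\<bar>)"
        unfolding t_def abs_mult[of "measure_pmf.expectation \<kappa> (\<lambda>x. \<Prod>j\<in>T. u j x)"]
      proof (rule mult_mono)
        have "measure_pmf.expectation \<kappa> (\<lambda>x. \<Prod>j\<in>T. u j x) \<in> {-1..1}"
        proof (rule expectation_mem_Icc[OF finite_\<kappa>])
          fix x
          have "\<bar>\<Prod>j\<in>T. u j x\<bar> = 1" by (simp add: abs_prod)
          then show "(\<Prod>j\<in>T. u j x) \<in> {-1..1}" by auto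
        qed
        then show "\<bar>measure_pmf.expectation \<kappa> (\<lambda>x. \<Prod>j\<in>T. u j x)\<bar> \<le> 1" by auto
        have "\<bar>?E (\<lambda>M. (\<Prod>j\<in>J - T. ?A j M) * (\<Prod>j\<in>T. ?B j M))\<bar>
            \<le> ?E (\<lambda>M. \<bar>(\<Prod>j\<in>J - T. ?A j M) * (\<Prod>j\<in>T. ?B j M)\<bar>)"
          by (rule integral_abs_bound)
        also have "\<dots> \<le> ?E (\<lambda>M. \<bar>?B a M * ?B b M * ?B e M\<bar>)"
          using assms(1) A B abe \<open>finite T\<close> by (intro expectation_mono prod_abs_le_three) auto
        finally show "\<bar>?E (\<lambda>M. (\<Prod>j\<in>J - T. ?A j M) * (\<Prod>j\<in>T. ?B j M))\<bar>
            \<le> ?E (\<lambda>M. \<bar>?B a M * ?B b M * ?B e M\<bar>)" .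
      qed auto
      also have "?E (\<lambda>M. \<bar>?B a M * ?B b M * ?B e M\<bar>) \<le> sqrt \<theta> * ?v"
        unfolding influence_insert_self[OF assms(2)]
        using assms T abe by (intro expectation_row_poly_triple) (auto simp: influence_insert_self)
      finally show ?thesis by simp
    qed
  qed
  have "\<bar>\<Sum>T\<in>Pow J - {{}}. t T\<bar> \<le> (\<Sum>T\<in>Pow J - {{}}. sqrt \<theta> * ?v)"
    using bound by (intro sum_abs[THEN order_trans] sum_mono) auto
  also have "\<dots> \<le> (\<Sum>T\<in>Pow J. sqrt \<theta> * ?v)"
    using finite_J v assms by (intro sum_mono2) auto
  also have "\<dots> = 2 ^ card J * (sqrt \<theta> * ?v)"
    using finite_J by (simp add: card_Pow)
  finally show ?thesis unfolding diff .
qed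

lemma expectation_prod_row_poly:
  assumes "finite I"
    and "\<And>z. (\<And>i. z i = 1 \<or> z i = - 1) \<Longrightarrow> \<bar>mlpoly I c z\<bar> \<le> 1"
    and "\<And>i. i \<in> I \<Longrightarrow> influence I c i \<le> \<theta>" and "\<theta> > 0"
  shows "\<bar>measure_pmf.expectation (columns I) (\<lambda>M. \<Prod>j\<in>J. row_poly I c j M) - c {} ^ card J\<bar>
    \<le> 2 ^ card J * (sqrt \<theta> * (\<Sum>i\<in>I. influence I c i))"
  using assms(1-3)
proof (induction I rule: finite_induct)
  case empty
  then show ?case by (simp add: mlpoly_def)
next
  case (insert i I)
  let ?A = "mlpoly I c" and ?B = "mlpoly I (\<lambda>S. c (insert i S))"
  have bounds: "\<bar>?A z\<bar> \<le> 1" "\<bar>?B z\<bar> \<le> 1" if z: "\<And>i. z i = 1 \<or> z i = - 1" for z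
  proof -
    have "mlpoly (insert i I) c (z(i := s)) = ?A z + s * ?B z" for s
    proof -
      have "mlpoly I c' (z(i := s)) = mlpoly I c' z" for c'
        by (rule mlpoly_cong) (use insert.hyps in auto)
      then show ?thesis using insert.hyps by (simp add: mlpoly_insert)
    qed
    moreover have "\<bar>mlpoly (insert i I) c (z(i := s))\<bar> \<le> 1" if "s = 1 \<or> s = - 1" for s
      using z that by (intro insert.prems(1)) auto
    ultimately have "\<bar>?A z + ?B z\<bar> \<le> 1" "\<bar>?A z - ?B z\<bar> \<le> 1"
      by (metis mult_1, metis diff_conv_add_uminus mult_minus1)
    then show "\<bar>?A z\<bar> \<le> 1" "\<bar>?B z\<bar> \<le> 1" by linarith+
  qed
  have mono: "influence I c l \<le> influence (insert i I) c l" for l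
    using insert.hyps by (intro influence_mono) auto
  have "\<bar>measure_pmf.expectation (columns (insert i I)) (\<lambda>M. \<Prod>j\<in>J. row_poly (insert i I) c j M) -
      measure_pmf.expectation (columns I) (\<lambda>M. \<Prod>j\<in>J. row_poly I c j M)\<bar>
    \<le> 2 ^ card J * (sqrt \<theta> * influence (insert i I) c i)"
    using insert.hyps insert.prems(2) assms(4) by (intro replace_column bounds sign) auto
  moreover have "\<bar>measure_pmf.expectation (columns I) (\<lambda>M. \<Prod>j\<in>J. row_poly I c j M) - c {} ^ card J\<bar>
    \<le> 2 ^ card J * (sqrt \<theta> * (\<Sum>l\<in>I. influence I c l))"
    using bounds(1) insert.prems(2) mono by (intro insert.IH) (auto intro: order_trans)
  moreover have "2 ^ card J * (sqrt \<theta> * (\<Sum>l\<in>I. influence I c l))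
      \<le> 2 ^ card J * (sqrt \<theta> * (\<Sum>l\<in>I. influence (insert i I) c l))"
    using assms(4) by (intro mult_left_mono sum_mono mono) auto
  moreover have "2 ^ card J * (sqrt \<theta> * (\<Sum>l\<in>insert i I. influence (insert i I) c l)) =
      2 ^ card J * (sqrt \<theta> * influence (insert i I) c i) +
      2 ^ card J * (sqrt \<theta> * (\<Sum>l\<in>I. influence (insert i I) c l))"
    using insert.hyps by (simp add: algebra_simps)
  ultimately show ?case by linarith
qed

lemma expectation_prod_quasirandom:
  assumes "finite I" and "0 < \<rho>" and "\<rho> < 1" and "\<tau> > 0"
    and bounded: "\<And>z. (\<And>i. \<bar>z i\<bar> \<le> 1) \<Longrightarrow> \<bar>mlpoly I c z\<bar> \<le> 1"
    and low: "\<And>i. i \<in> I \<Longrightarrow> (\<Sum>S | S \<subseteq> I \<and> i \<in> S \<and> card S \<le> d. (c S)\<^sup>2) \<le> \<tau>"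
  shows "\<bar>measure_pmf.expectation (columns I)
        (\<lambda>M. \<Prod>j\<in>J. row_poly I (\<lambda>S. \<rho> ^ card S * c S) j M) - c {} ^ card J\<bar>
    \<le> 2 ^ card J * (sqrt (\<tau> + \<rho> ^ d) / (1 - \<rho>))"
proof (cases "J = {}")
  case True
  then show ?thesis using assms by simp
next
  case False
  then obtain j where j: "j \<in> J" by auto
  let ?e = "\<lambda>S. \<rho> ^ card S * c S"
  have "(\<Sum>S\<in>Pow I. (c S)\<^sup>2) = measure_pmf.expectation (columns I) (\<lambda>M. (row_poly I c j M)\<^sup>2)"
    using assms(1) j by (simp add: expectation_row_poly_square)
  also have "\<dots> \<le> 1"
    using expectation_mem_Icc[of "columns I" "\<lambda>M. (row_poly I c j M)\<^sup>2" 0 1] assms(1) bounded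
    by (simp add: abs_square_le_1)
  finally have parseval: "(\<Sum>S\<in>Pow I. (c S)\<^sup>2) \<le> 1" .
  have pow1: "\<rho> ^ m \<le> 1" for m
    using assms by (simp add: power_le_one)
  have infl: "influence I ?e i \<le> \<tau> + \<rho> ^ d" if "i \<in> I" for i
  proof -
    have "influence I ?e i \<le>
        (\<Sum>S | S \<subseteq> I \<and> i \<in> S. (if card S \<le> d then (c S)\<^sup>2 else 0) + \<rho> ^ d * (c S)\<^sup>2)"
      unfolding influence_def
    proof (rule sum_mono)
      fix S
      have "(?e S)\<^sup>2 \<le> (c S)\<^sup>2" "d \<le> card S \<Longrightarrow> (?e S)\<^sup>2 \<le> \<rho> ^ d * (c S)\<^sup>2"
      proof -
        have eq: "(?e S)\<^sup>2 = \<rho> ^ card S * \<rho> ^ card S * (c S)\<^sup>2"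
          by (simp add: power_mult_distrib power2_eq_square)
        have "\<rho> ^ card S * \<rho> ^ card S \<le> \<rho> ^ card S"
          using assms pow1 by (simp add: mult_left_le)
        then have le: "(?e S)\<^sup>2 \<le> \<rho> ^ card S * (c S)\<^sup>2"
          unfolding eq by (intro mult_right_mono) auto
        have "\<rho> ^ card S * (c S)\<^sup>2 \<le> 1 * (c S)\<^sup>2"
          by (intro mult_right_mono pow1) auto
        with le show "(?e S)\<^sup>2 \<le> (c S)\<^sup>2" by simp
        assume "d \<le> card S"
        then have "\<rho> ^ card S * (c S)\<^sup>2 \<le> \<rho> ^ d * (c S)\<^sup>2"
          using assms by (intro mult_right_mono power_decreasing) auto
        with le show "(?e S)\<^sup>2 \<le> \<rho> ^ d * (c S)\<^sup>2" by simp
      qed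
      moreover have "0 \<le> \<rho> ^ d * (c S)\<^sup>2"
        using assms by simp
      ultimately show "(?e S)\<^sup>2 \<le> (if card S \<le> d then (c S)\<^sup>2 else 0) + \<rho> ^ d * (c S)\<^sup>2"
        by (cases "card S \<le> d") auto
    qed
    also have "\<dots> = (\<Sum>S | S \<subseteq> I \<and> i \<in> S. if card S \<le> d then (c S)\<^sup>2 else 0)
        + \<rho> ^ d * (\<Sum>S | S \<subseteq> I \<and> i \<in> S. (c S)\<^sup>2)"
      by (simp add: sum.distrib sum_distrib_left)
    also have "(\<Sum>S | S \<subseteq> I \<and> i \<in> S. if card S \<le> d then (c S)\<^sup>2 else 0) =
        (\<Sum>S | S \<subseteq> I \<and> i \<in> S \<and> card S \<le> d. (c S)\<^sup>2)"
      using assms(1) sum.inter_filter[of "{S. S \<subseteq> I \<and> i \<in> S}" "\<lambda>S. (c S)\<^sup>2" "\<lambda>S. card S \<le> d"]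
      by simp
    also have "\<dots> + \<rho> ^ d * (\<Sum>S | S \<subseteq> I \<and> i \<in> S. (c S)\<^sup>2) \<le> \<tau> + \<rho> ^ d * 1"
    proof (intro add_mono low[OF that] mult_left_mono)
      show "(\<Sum>S | S \<subseteq> I \<and> i \<in> S. (c S)\<^sup>2) \<le> 1"
        using assms(1) by (intro order_trans[OF _ parseval] sum_mono2) auto
    qed (use assms in simp)
    finally show ?thesis by simp
  qed
  have geometric: "real m * \<rho> ^ m \<le> 1 / (1 - \<rho>)" for m
  proof -
    have "real m * \<rho> ^ m = (\<Sum>l<m. \<rho> ^ m)" by simp
    also have "\<dots> \<le> (\<Sum>l<m. \<rho> ^ l)"
      using assms by (intro sum_mono power_decreasing) auto
    also have "\<dots> = (1 - \<rho> ^ m) / (1 - \<rho>)"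
      using assms sum_gp_strict[of \<rho> m] by simp
    also have "\<dots> \<le> 1 / (1 - \<rho>)"
      using assms by (intro divide_right_mono) auto
    finally show ?thesis .
  qed
  have "(\<Sum>i\<in>I. influence I ?e i) = (\<Sum>i\<in>I. \<Sum>S\<in>Pow I. if i \<in> S then (?e S)\<^sup>2 else 0)"
  proof (rule sum.cong)
    fix i
    show "influence I ?e i = (\<Sum>S\<in>Pow I. if i \<in> S then (?e S)\<^sup>2 else 0)"
      unfolding influence_def
      using assms(1) sum.inter_filter[of "Pow I" "\<lambda>S. (?e S)\<^sup>2" "\<lambda>S. i \<in> S"] by simp
  qed simp
  also have "\<dots> = (\<Sum>S\<in>Pow I. \<Sum>i\<in>I. if i \<in> S then (?e S)\<^sup>2 else 0)"
    by (rule sum.swap)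
  also have "\<dots> = (\<Sum>S\<in>Pow I. real (card S) * (?e S)\<^sup>2)"
  proof (rule sum.cong)
    fix S assume "S \<in> Pow I"
    then have "I \<inter> S = S" by auto
    then show "(\<Sum>i\<in>I. if i \<in> S then (?e S)\<^sup>2 else 0) = real (card S) * (?e S)\<^sup>2"
      using assms(1) by (simp add: sum.inter_restrict[symmetric])
  qed simp
  also have "\<dots> \<le> (\<Sum>S\<in>Pow I. 1 / (1 - \<rho>) * (c S)\<^sup>2)"
  proof (rule sum_mono)
    fix S
    have "real (card S) * (?e S)\<^sup>2 = real (card S) * \<rho> ^ card S * (\<rho> ^ card S * (c S)\<^sup>2)"
      by (simp add: power_mult_distrib power2_eq_square)
    also have "\<dots> \<le> 1 / (1 - \<rho>) * (1 * (c S)\<^sup>2)"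
      using assms by (intro mult_mono geometric mult_right_mono pow1) auto
    finally show "real (card S) * (?e S)\<^sup>2 \<le> 1 / (1 - \<rho>) * (c S)\<^sup>2" by simp
  qed
  also have "\<dots> \<le> 1 / (1 - \<rho>) * 1"
    unfolding sum_distrib_left[symmetric] using assms by (intro mult_left_mono parseval) auto
  finally have total: "(\<Sum>i\<in>I. influence I ?e i) \<le> 1 / (1 - \<rho>)" by simp
  have "\<bar>measure_pmf.expectation (columns I) (\<lambda>M. \<Prod>j\<in>J. row_poly I ?e j M) - ?e {} ^ card J\<bar>
      \<le> 2 ^ card J * (sqrt (\<tau> + \<rho> ^ d) * (\<Sum>i\<in>I. influence I ?e i))"
  proof (rule expectation_prod_row_poly[OF assms(1) _ infl])
    show "\<bar>mlpoly I ?e z\<bar> \<le> 1" if z: "\<And>i. z i = 1 \<or> z i = - 1" for z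
    proof -
      have "\<bar>\<rho> * z i\<bar> \<le> 1" for i
        using z[of i] assms by auto
      from bounded[OF this] show ?thesis by (simp add: mlpoly_scale)
    qed
    show "0 < \<tau> + \<rho> ^ d"
      using assms by (simp add: add_pos_pos)
  qed
  also have "\<dots> \<le> 2 ^ card J * (sqrt (\<tau> + \<rho> ^ d) * (1 / (1 - \<rho>)))"
    using assms by (intro mult_left_mono total) auto
  finally show ?thesis by simp
qed

end

subsection \<open>The noisy product test\<close>

definition product_bernoulli :: "nat \<Rightarrow> (nat \<Rightarrow> real) \<Rightarrow> point pmf" where
  "product_bernoulli n y = Pi_pmf {..<n} undefined (\<lambda>i. map_pmf of_bool (bernoulli_pmf (y i)))"

lemma set_product_bernoulli: "set_pmf (product_bernoulli n y) \<subseteq> cube n"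
  unfolding product_bernoulli_def cube_def
  by (subst set_Pi_pmf) (auto simp: PiE_dflt_def PiE_def extensional_def)

lemma finite_cube [simp]: "finite (cube n)"
  unfolding cube_def by (intro finite_PiE) auto

lemma finite_product_bernoulli [simp]: "finite (set_pmf (product_bernoulli n y))"
  using set_product_bernoulli finite_cube by (rule finite_subset)

lemma expectation_product_bernoulli:
  assumes "\<And>i. i < n \<Longrightarrow> y i \<in> {0..1}"
  shows "measure_pmf.expectation (product_bernoulli n y) (\<lambda>x. mlpoly {..<n} c (\<lambda>i. a + b * x i)) =
    mlpoly {..<n} c (\<lambda>i. a + b * y i)"
proof -
  have "measure_pmf.expectation (product_bernoulli n y) (\<lambda>x. mlpoly {..<n} c (\<lambda>i. a + b * x i)) =
      mlpoly {..<n} c (\<lambda>i. measure_pmf.expectation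
        (map_pmf of_bool (bernoulli_pmf (y i))) (\<lambda>t. a + b * t))"
    unfolding product_bernoulli_def by (rule expectation_mlpoly) auto
  also have "\<dots> = mlpoly {..<n} c (\<lambda>i. a + b * y i)"
    using assms by (intro mlpoly_cong) (auto simp: integral_bernoulli_pmf algebra_simps)
  finally show ?thesis .
qed

lemma expectation_product_bernoulli_mem:
  fixes F :: "point \<Rightarrow> real"
  assumes "F \<in> cube n \<rightarrow> {a..b}"
  shows "measure_pmf.expectation (product_bernoulli n y) F \<in> {a..b}"
proof (rule expectation_mem_Icc)
  fix x assume "x \<in> set_pmf (product_bernoulli n y)"
  then have "x \<in> cube n" using set_product_bernoulli by blast
  then show "F x \<in> {a..b}" by (rule funcset_mem[OF assms])
qed simp

definition noisy_row :: "real \<Rightarrow> nat \<Rightarrow> (nat \<Rightarrow> point) \<Rightarrow> nat \<Rightarrow> real" where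
  "noisy_row \<eta> j M i = (1 - \<eta>) * M i j + \<eta> / 2"

definition noisy_queries :: "nat \<Rightarrow> point pmf \<Rightarrow> real \<Rightarrow> nat \<Rightarrow> (nat \<Rightarrow> point) pmf" where
  "noisy_queries k \<mu> \<eta> n = bind_pmf (Pi_pmf {..<n} undefined (\<lambda>_. \<mu>))
     (\<lambda>M. Pi_pmf {..<k} undefined (\<lambda>j. product_bernoulli n (noisy_row \<eta> j M)))"

definition noisy_test ::
    "nat \<Rightarrow> (point \<Rightarrow> real) \<Rightarrow> point pmf \<Rightarrow> real \<Rightarrow> nat \<Rightarrow> (point \<Rightarrow> real) \<Rightarrow> bool pmf" where
  "noisy_test k f \<mu> \<eta> n F =
     bind_pmf (noisy_queries k \<mu> \<eta> n) (\<lambda>x. bernoulli_pmf (f (\<lambda>j\<in>{..<k}. F (x j))))"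

lemma set_noisy_queries: "set_pmf (noisy_queries k \<mu> \<eta> n) \<subseteq> {..<k} \<rightarrow>\<^sub>E cube n"
proof -
  have "set_pmf (Pi_pmf {..<k} undefined (\<lambda>j. product_bernoulli n (y j))) \<subseteq> {..<k} \<rightarrow>\<^sub>E cube n" for y
    using set_product_bernoulli
    by (subst set_Pi_pmf) (auto simp: PiE_dflt_def PiE_def extensional_def)
  then show ?thesis
    unfolding noisy_queries_def set_bind_pmf by (intro UN_least)
qed

lemma is_query_test_noisy_test: "is_query_test k f n (noisy_test k f \<mu> \<eta> n)"
  unfolding is_query_test_def noisy_test_def using set_noisy_queries by blast

lemma cube_subset_solid_cube: "cube n \<subseteq> solid_cube n"
  unfolding cube_def solid_cube_def by (intro PiE_mono) auto

lemma multilinear_extension_mlpoly: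
  assumes "multilinear_extension k G f" and "G \<in> cube k \<rightarrow> {0..1}"
  shows "\<exists>c. (\<forall>y\<in>solid_cube k. f y = mlpoly {..<k} c y \<and> f y \<in> {0..1}) \<and>
    (\<forall>p\<in>{0..1}. s_biased k f p = mlpoly {..<k} c (\<lambda>_. p))"
proof -
  from assms(1) obtain c where c: "\<And>y. y \<in> solid_cube k \<Longrightarrow> f y = mlpoly {..<k} c y"
    and G: "\<And>x. x \<in> cube k \<Longrightarrow> f x = G x"
    unfolding multilinear_extension_def multilinear_poly_eq_mlpoly by (elim conjE exE) simp
  have avg: "measure_pmf.expectation (product_bernoulli k y) f = mlpoly {..<k} c y"
    if "\<And>i. i < k \<Longrightarrow> y i \<in> {0..1}" for y
  proof -
    have "measure_pmf.expectation (product_bernoulli k y) f =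
        measure_pmf.expectation (product_bernoulli k y) (\<lambda>x. mlpoly {..<k} c (\<lambda>i. 0 + 1 * x i))"
    proof (rule expectation_cong)
      fix x assume "x \<in> set_pmf (product_bernoulli k y)"
      then have "x \<in> solid_cube k" using set_product_bernoulli cube_subset_solid_cube by blast
      then show "f x = mlpoly {..<k} c (\<lambda>i. 0 + 1 * x i)" by (simp add: c)
    qed
    also have "\<dots> = mlpoly {..<k} c (\<lambda>i. 0 + 1 * y i)"
      by (rule expectation_product_bernoulli[OF that])
    finally show ?thesis by simp
  qed
  show ?thesis
  proof (intro exI[of _ c] conjI ballI)
    show "s_biased k f p = mlpoly {..<k} c (\<lambda>_. p)" if "p \<in> {0..1}" for p
      unfolding s_biased_def biased_cube_pmf_def product_bernoulli_def[symmetric]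
      by (rule avg) (rule that)
    fix y assume y: "y \<in> solid_cube k"
    show "f y = mlpoly {..<k} c y" using y by (rule c)
    have "f \<in> cube k \<rightarrow> {0..1}"
      using G assms(2) by (simp add: Pi_iff)
    then have "measure_pmf.expectation (product_bernoulli k y) f \<in> {0..1}"
      by (rule expectation_product_bernoulli_mem)
    moreover have "y i \<in> {0..1}" if "i < k" for i
      using PiE_mem[OF y[unfolded solid_cube_def], of i] that by simp
    ultimately show "f y \<in> {0..1}"
      using avg[of y] c[OF y] by simp
  qed
qed

lemma accept_prob_noisy_test:
  assumes "finite (set_pmf \<mu>)" and F: "F \<in> cube n \<rightarrow> {0..1}"
    and c: "\<And>y. y \<in> solid_cube k \<Longrightarrow> f y = mlpoly {..<k} c y"
    and range: "\<And>y. y \<in> solid_cube k \<Longrightarrow> f y \<in> {0..1}"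
  shows "accept_prob (noisy_test k f \<mu> \<eta> n F) =
    measure_pmf.expectation (Pi_pmf {..<n} undefined (\<lambda>_. \<mu>)) (\<lambda>M.
      mlpoly {..<k} c (\<lambda>j. measure_pmf.expectation (product_bernoulli n (noisy_row \<eta> j M)) F))"
proof -
  let ?R = "\<lambda>x. \<lambda>j\<in>{..<k}. F (x j)"
  have solid: "?R x \<in> solid_cube k" if "x \<in> set_pmf (noisy_queries k \<mu> \<eta> n)" for x
    using that set_noisy_queries[of k \<mu> \<eta> n] F by (fastforce simp: solid_cube_def)
  have "accept_prob (noisy_test k f \<mu> \<eta> n F) =
      measure_pmf.expectation (noisy_queries k \<mu> \<eta> n) (\<lambda>x. pmf (bernoulli_pmf (f (?R x))) True)"
    by (simp add: accept_prob_def noisy_test_def pmf_bind)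
  also have "\<dots> = measure_pmf.expectation (noisy_queries k \<mu> \<eta> n) (\<lambda>x. mlpoly {..<k} c (\<lambda>j. F (x j)))"
  proof (rule expectation_cong)
    fix x assume "x \<in> set_pmf (noisy_queries k \<mu> \<eta> n)"
    then have "?R x \<in> solid_cube k" by (rule solid)
    moreover have "mlpoly {..<k} c (?R x) = mlpoly {..<k} c (\<lambda>j. F (x j))"
      by (rule mlpoly_cong) auto
    ultimately show "pmf (bernoulli_pmf (f (?R x))) True = mlpoly {..<k} c (\<lambda>j. F (x j))"
      using c[of "?R x"] range[of "?R x"] by simp
  qed
  also have "\<dots> = measure_pmf.expectation (Pi_pmf {..<n} undefined (\<lambda>_. \<mu>)) (\<lambda>M.
      measure_pmf.expectation (Pi_pmf {..<k} undefined (\<lambda>j. product_bernoulli n (noisy_row \<eta> j M)))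
        (\<lambda>x. mlpoly {..<k} c (\<lambda>j. F (x j))))"
    unfolding noisy_queries_def using assms(1)
    by (intro expectation_bind_finite finite_set_Pi_pmf) auto
  also have "\<dots> = measure_pmf.expectation (Pi_pmf {..<n} undefined (\<lambda>_. \<mu>)) (\<lambda>M.
      mlpoly {..<k} c (\<lambda>j. measure_pmf.expectation (product_bernoulli n (noisy_row \<eta> j M)) F))"
    by (intro expectation_cong expectation_mlpoly) auto
  finally show ?thesis .
qed

lemma mlpoly_lipschitz:
  fixes z w :: "'i \<Rightarrow> real" and \<delta> :: real
  assumes "finite I" and "\<And>i. i \<in> I \<Longrightarrow> z i \<in> {0..1}" and "\<And>i. i \<in> I \<Longrightarrow> w i \<in> {0..1}"
    and "\<And>i. i \<in> I \<Longrightarrow> \<bar>z i - w i\<bar> \<le> \<delta>"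
  shows "\<bar>mlpoly I c z - mlpoly I c w\<bar> \<le> (\<Sum>S\<in>Pow I. \<bar>c S\<bar>) * (card I * \<delta>)"
proof -
  have "\<bar>mlpoly I c z - mlpoly I c w\<bar> = \<bar>\<Sum>S\<in>Pow I. c S * ((\<Prod>i\<in>S. z i) - (\<Prod>i\<in>S. w i))\<bar>"
    by (simp add: mlpoly_def sum_subtractf algebra_simps)
  also have "\<dots> \<le> (\<Sum>S\<in>Pow I. \<bar>c S\<bar> * (card I * \<delta>))"
  proof (rule sum_abs[THEN order_trans], rule sum_mono)
    fix S assume S: "S \<in> Pow I"
    have "\<bar>(\<Prod>i\<in>S. z i) - (\<Prod>i\<in>S. w i)\<bar> \<le> (\<Sum>i\<in>S. \<bar>z i - w i\<bar>)"
      using norm_prod_diff[of S z w] S assms(2,3) by (force simp: real_norm_def)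
    also have "\<dots> \<le> (\<Sum>i\<in>I. \<bar>z i - w i\<bar>)"
      using S assms(1) by (intro sum_mono2) auto
    also have "\<dots> \<le> (\<Sum>i\<in>I. \<delta>)"
      by (intro sum_mono assms(4))
    finally have "\<bar>(\<Prod>i\<in>S. z i) - (\<Prod>i\<in>S. w i)\<bar> \<le> card I * \<delta>" by simp
    then show "\<bar>c S * ((\<Prod>i\<in>S. z i) - (\<Prod>i\<in>S. w i))\<bar> \<le> \<bar>c S\<bar> * (card I * \<delta>)"
      unfolding abs_mult by (intro mult_left_mono) auto
  qed
  also have "\<dots> = (\<Sum>S\<in>Pow I. \<bar>c S\<bar>) * (card I * \<delta>)"
    by (simp add: sum_distrib_right)
  finally show ?thesis .
qed

lemma noisy_row_mem:
  assumes "M i j \<in> {0, 1}" and "0 < \<eta>" and "\<eta> \<le> 1 / 2"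
  shows "noisy_row \<eta> j M i \<in> {0..1}" and "\<bar>noisy_row \<eta> j M i - M i j\<bar> = \<eta> / 2"
  using assms by (auto simp: noisy_row_def abs_if)

lemma columns_mem_cube:
  fixes n :: nat
  assumes "set_pmf \<mu> \<subseteq> cube k" and "M \<in> set_pmf (Pi_pmf {..<n} undefined (\<lambda>_. \<mu>))"
    and "i < n" and "j < k"
  shows "M i j \<in> {0, 1}"
proof -
  have "M i \<in> set_pmf \<mu>"
    using assms(2,3) set_Pi_pmf_subset'[of "{..<n}" undefined "\<lambda>_. \<mu>"]
    by (auto simp: PiE_dflt_def)
  then show ?thesis using assms(1,4) by (auto simp: cube_def)
qed

lemma noisy_test_complete:
  assumes \<mu>: "set_pmf \<mu> \<subseteq> cube k" and F: "F \<in> cube n \<rightarrow> {0..1}"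
    and c: "\<And>y. y \<in> solid_cube k \<Longrightarrow> f y = mlpoly {..<k} c y"
    and range: "\<And>y. y \<in> solid_cube k \<Longrightarrow> f y \<in> {0..1}"
    and \<eta>: "0 < \<eta>" "\<eta> \<le> 1 / 2" and "dictator n F"
  shows "accept_prob (noisy_test k f \<mu> \<eta> n F) \<ge>
    c_val \<mu> f - (\<Sum>S\<in>Pow {..<k}. \<bar>c S\<bar>) * (k * (\<eta> / 2))"
proof -
  obtain l where l: "l < n" "\<And>x. x \<in> cube n \<Longrightarrow> F x = x l"
    using assms(7) by (auto simp: dictator_def)
  let ?P = "Pi_pmf {..<n} undefined (\<lambda>_. \<mu>)"
  let ?\<delta> = "(\<Sum>S\<in>Pow {..<k}. \<bar>c S\<bar>) * (k * (\<eta> / 2))"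
  have fin: "finite (set_pmf \<mu>)"
    using \<mu> finite_cube by (rule finite_subset)
  then have finP: "finite (set_pmf ?P)"
    by (intro finite_set_Pi_pmf) auto
  have "c_val \<mu> f = measure_pmf.expectation (map_pmf (\<lambda>M. M l) ?P) f"
    using l by (simp add: c_val_def Pi_pmf_component del: integral_map_pmf)
  then have "c_val \<mu> f - ?\<delta> = measure_pmf.expectation ?P (\<lambda>M. f (M l) - ?\<delta>)"
    using finP by (simp add: integrable_measure_pmf_finite)
  also have "\<dots> \<le> measure_pmf.expectation ?P (\<lambda>M.
      mlpoly {..<k} c (\<lambda>j. measure_pmf.expectation (product_bernoulli n (noisy_row \<eta> j M)) F))"
  proof (rule expectation_mono[OF finP])
    fix M assume M: "M \<in> set_pmf ?P"
    have bits: "M i j \<in> {0, 1}" if "i < n" "j < k" for i j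
      using columns_mem_cube[OF \<mu> M] that .
    have "M l \<in> set_pmf \<mu>"
      using M l set_Pi_pmf_subset'[of "{..<n}" undefined "\<lambda>_. \<mu>"]
      by (auto simp: PiE_dflt_def)
    then have "M l \<in> solid_cube k"
      using \<mu> cube_subset_solid_cube by blast
    have "mlpoly {..<k} c (\<lambda>j. measure_pmf.expectation (product_bernoulli n (noisy_row \<eta> j M)) F) =
        mlpoly {..<k} c (\<lambda>j. noisy_row \<eta> j M l)"
    proof (rule mlpoly_cong)
      fix j assume "j \<in> {..<k}"
      have "measure_pmf.expectation (product_bernoulli n (noisy_row \<eta> j M)) F =
          measure_pmf.expectation (map_pmf (\<lambda>x. x l) (product_bernoulli n (noisy_row \<eta> j M))) (\<lambda>t. t)"
        unfolding integral_map_pmf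
        using l set_product_bernoulli by (intro expectation_cong) auto
      also have "\<dots> = noisy_row \<eta> j M l"
        using noisy_row_mem(1)[of M l j \<eta>] bits[of l j] \<open>j \<in> {..<k}\<close> l \<eta>
        by (simp add: product_bernoulli_def Pi_pmf_component)
      finally show "measure_pmf.expectation (product_bernoulli n (noisy_row \<eta> j M)) F =
          noisy_row \<eta> j M l" .
    qed simp
    moreover have "\<bar>mlpoly {..<k} c (\<lambda>j. noisy_row \<eta> j M l) - mlpoly {..<k} c (M l)\<bar> \<le>
        (\<Sum>S\<in>Pow {..<k}. \<bar>c S\<bar>) * (card {..<k} * (\<eta> / 2))"
    proof (rule mlpoly_lipschitz)
      fix j assume "j \<in> {..<k}"
      then have bit: "M l j \<in> {0, 1}" using bits l by auto
      then show "M l j \<in> {0..1}" by auto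
      show "noisy_row \<eta> j M l \<in> {0..1}" "\<bar>noisy_row \<eta> j M l - M l j\<bar> \<le> \<eta> / 2"
        using noisy_row_mem[of M l j, OF bit \<eta>] by auto
    qed simp
    ultimately show "f (M l) - ?\<delta> \<le>
        mlpoly {..<k} c (\<lambda>j. measure_pmf.expectation (product_bernoulli n (noisy_row \<eta> j M)) F)"
      using c[OF \<open>M l \<in> solid_cube k\<close>] unfolding card_lessThan abs_le_iff by linarith
  qed
  also have "\<dots> = accept_prob (noisy_test k f \<mu> \<eta> n F)"
    using accept_prob_noisy_test[OF fin F c range] by simp
  finally show ?thesis .
qed

definition bit_sign :: "nat \<Rightarrow> point \<Rightarrow> real" where
  "bit_sign j x = (if x j = 1 then - 1 else 1)"

lemma pairwise_signs_bit_sign: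
  assumes "balanced_pairwise_independent k \<mu>" and "k \<ge> 2" and "J \<subseteq> {..<k}"
  shows "pairwise_signs \<mu> bit_sign J"
proof
  have \<mu>: "set_pmf \<mu> \<subseteq> cube k"
    using assms(1) by (simp add: balanced_pairwise_independent_def)
  show fin: "finite (set_pmf \<mu>)"
    using \<mu> finite_cube by (rule finite_subset)
  show "finite J"
    using assms(3) finite_subset by blast
  show "bit_sign j x = 1 \<or> bit_sign j x = - 1" for j x
    by (simp add: bit_sign_def)
  let ?ind = "\<lambda>j l a b. indicat_real {x. x j = a \<and> x l = b} :: point \<Rightarrow> real"
  have quarter: "measure_pmf.expectation \<mu> (?ind j l a b) = 1 / 4"
    if "j < k" "l < k" "j \<noteq> l" "a \<in> {0, 1}" "b \<in> {0, 1}" for j l and a b :: real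
  proof -
    have "measure_pmf.prob \<mu> {x. x i = b\<^sub>1 \<and> x j = b\<^sub>2} = 1 / 4"
      if "j < k" "i < j" "b\<^sub>1 \<in> {0, 1}" "b\<^sub>2 \<in> {0, 1}" for i j b\<^sub>1 b\<^sub>2
      using assms(1) that unfolding balanced_pairwise_independent_def by blast
    from this[of l j a b] this[of j l b a] that show ?thesis
      by (cases "j < l") (auto simp: conj_commute)
  qed
  have bits: "x j = 0 \<or> x j = 1" if "x \<in> set_pmf \<mu>" "j < k" for x j
    using that \<mu> by (auto simp: cube_def)
  have expand: "measure_pmf.expectation \<mu> h = 0"
    if "j < k" "l < k" "j \<noteq> l"
      and "\<And>x. x \<in> set_pmf \<mu> \<Longrightarrow> h x = ?ind j l 0 0 x + s * ?ind j l 1 1 x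
        + t * ?ind j l 0 1 x + r * ?ind j l 1 0 x"
      and "1 + s + t + r = 0" for j l s t r and h :: "point \<Rightarrow> real"
  proof -
    have quarters: "measure_pmf.expectation \<mu> (?ind j l 0 0) = 1 / 4"
      "measure_pmf.expectation \<mu> (?ind j l 1 1) = 1 / 4"
      "measure_pmf.expectation \<mu> (?ind j l 0 1) = 1 / 4"
      "measure_pmf.expectation \<mu> (?ind j l 1 0) = 1 / 4"
      by (intro quarter that(1-3); simp)+
    have "measure_pmf.expectation \<mu> h = measure_pmf.expectation \<mu> (\<lambda>x.
        ?ind j l 0 0 x + s * ?ind j l 1 1 x + t * ?ind j l 0 1 x + r * ?ind j l 1 0 x)"
      by (intro expectation_cong that)
    also have "\<dots> = measure_pmf.expectation \<mu> (?ind j l 0 0)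
        + s * measure_pmf.expectation \<mu> (?ind j l 1 1)
        + t * measure_pmf.expectation \<mu> (?ind j l 0 1)
        + r * measure_pmf.expectation \<mu> (?ind j l 1 0)"
      using integrable_measure_pmf_finite[OF fin, where 'b = real]
      by (simp only: Bochner_Integration.integral_add integrable_mult_right
          Bochner_Integration.integrable_add integral_mult_right_zero)
    also have "\<dots> = (1 + s + t + r) / 4"
      by (simp only: quarters) simp
    finally show ?thesis using that(5) by simp
  qed
  show "measure_pmf.expectation \<mu> (bit_sign j) = 0" if "j \<in> J" for j
  proof -
    have "j < k" using that assms(3) by auto
    define l :: nat where "l = (if j = 0 then 1 else 0)"
    have "l < k" "j \<noteq> l"
      using assms(2) by (auto simp: l_def)
    show ?thesis
    proof (rule expand[OF \<open>j < k\<close> \<open>l < k\<close> \<open>j \<noteq> l\<close>, of _ "-1" 1 "-1"])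
      fix x assume "x \<in> set_pmf \<mu>"
      with bits[OF this \<open>j < k\<close>] bits[OF this \<open>l < k\<close>]
      show "bit_sign j x = ?ind j l 0 0 x + - 1 * ?ind j l 1 1 x
          + 1 * ?ind j l 0 1 x + - 1 * ?ind j l 1 0 x"
        by (elim disjE) (simp_all add: bit_sign_def indicator_def)
    qed simp
  qed
  show "measure_pmf.expectation \<mu> (\<lambda>x. bit_sign j x * bit_sign l x) = 0"
    if "j \<in> J" "l \<in> J" "j \<noteq> l" for j l
  proof -
    have "j < k" "l < k" using that assms(3) by auto
    show ?thesis
    proof (rule expand[OF \<open>j < k\<close> \<open>l < k\<close> \<open>j \<noteq> l\<close>, of _ 1 "-1" "-1"])
      fix x assume "x \<in> set_pmf \<mu>"
      with bits[OF this \<open>j < k\<close>] bits[OF this \<open>l < k\<close>]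
      show "bit_sign j x * bit_sign l x = ?ind j l 0 0 x + 1 * ?ind j l 1 1 x
          + - 1 * ?ind j l 0 1 x + - 1 * ?ind j l 1 0 x"
        by (elim disjE) (simp_all add: bit_sign_def indicator_def)
    qed simp
  qed
qed

lemma s_biased_le_s_val:
  assumes "p \<in> {0..1}"
  shows "s_biased k f p \<le> s_val k f"
proof (rule s_val_is_max[of k f])
  assume "\<And>q. q \<in> {0..1} \<Longrightarrow> s_biased k f q \<le> s_val k f"
  then show ?thesis using assms .
qed

lemma noisy_test_sound:
  assumes \<mu>: "balanced_pairwise_independent k \<mu>" and "k \<ge> 2" and F: "F \<in> cube n \<rightarrow> {0..1}"
    and c: "\<And>y. y \<in> solid_cube k \<Longrightarrow> f y = mlpoly {..<k} c y"
    and s: "\<And>p. p \<in> {0..1} \<Longrightarrow> s_biased k f p = mlpoly {..<k} c (\<lambda>_. p)"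
    and range: "\<And>y. y \<in> solid_cube k \<Longrightarrow> f y \<in> {0..1}"
    and \<eta>: "0 < \<eta>" "\<eta> \<le> 1 / 2" and "\<tau> > 0" and "quasirandom n d \<tau> F"
  shows "accept_prob (noisy_test k f \<mu> \<eta> n F) \<le>
    s_val k f + (\<Sum>S\<in>Pow {..<k}. \<bar>c S\<bar>) * (2 ^ k * (sqrt (\<tau> + (1 - \<eta>) ^ d) / \<eta>))"
proof -
  let ?P = "Pi_pmf {..<n} undefined (\<lambda>_. \<mu>)"
  let ?T = "\<lambda>M j. measure_pmf.expectation (product_bernoulli n (noisy_row \<eta> j M)) F"
  define B where "B = sqrt (\<tau> + (1 - \<eta>) ^ d) / \<eta>"
  have "B \<ge> 0" using \<eta> \<open>\<tau> > 0\<close> by (simp add: B_def)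
  have sub: "set_pmf \<mu> \<subseteq> cube k"
    using \<mu> by (simp add: balanced_pairwise_independent_def)
  then have fin: "finite (set_pmf \<mu>)"
    using finite_cube by (rule finite_subset)
  then have finP: "finite (set_pmf ?P)"
    by (intro finite_set_Pi_pmf) auto
  obtain e where e: "\<And>x. x \<in> cube n \<Longrightarrow> F x = mlpoly {..<n} e (\<lambda>i. 1 - 2 * x i)"
    and low: "\<And>i. i < n \<Longrightarrow> (\<Sum>S | S \<subseteq> {..<n} \<and> i \<in> S \<and> card S \<le> d. (e S)\<^sup>2) \<le> \<tau>"
    using \<open>quasirandom n d \<tau> F\<close> unfolding quasirandom_def multilinear_poly_eq_mlpoly by blast
  have avg: "measure_pmf.expectation (product_bernoulli n y) F = mlpoly {..<n} e (\<lambda>i. 1 - 2 * y i)"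
    if "\<And>i. i < n \<Longrightarrow> y i \<in> {0..1}" for y
  proof -
    have "measure_pmf.expectation (product_bernoulli n y) F =
        measure_pmf.expectation (product_bernoulli n y) (\<lambda>x. mlpoly {..<n} e (\<lambda>i. 1 + (- 2) * x i))"
      using e set_product_bernoulli by (intro expectation_cong) auto
    also have "\<dots> = mlpoly {..<n} e (\<lambda>i. 1 + (- 2) * y i)"
      by (rule expectation_product_bernoulli[OF that])
    finally show ?thesis by simp
  qed
  have avg_mem: "measure_pmf.expectation (product_bernoulli n y) F \<in> {0..1}" for y
    using F by (rule expectation_product_bernoulli_mem)
  have interior: "mlpoly {..<n} e z \<in> {0..1}" if "\<And>i. \<bar>z i\<bar> \<le> 1" for z
  proof -
    have "(1 - z i) / 2 \<in> {0..1}" for i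
      using that[of i] by (auto simp: abs_le_iff)
    then have "measure_pmf.expectation (product_bernoulli n (\<lambda>i. (1 - z i) / 2)) F =
        mlpoly {..<n} e (\<lambda>i. 1 - 2 * ((1 - z i) / 2))"
      by (rule avg)
    also have "\<dots> = mlpoly {..<n} e z"
      by (rule mlpoly_cong) (auto simp: field_simps)
    finally have eq: "mlpoly {..<n} e z =
        measure_pmf.expectation (product_bernoulli n (\<lambda>i. (1 - z i) / 2)) F"
      by simp
    show ?thesis unfolding eq by (rule avg_mem)
  qed
  have p: "e {} \<in> {0..1}"
  proof -
    have "mlpoly {..<n} e (\<lambda>_. 0) = (\<Sum>S\<in>Pow {..<n}. if S = {} then e {} else 0)"
      unfolding mlpoly_def
      by (intro sum.cong) (auto simp: card_eq_0_iff dest: finite_subset)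
    then have "mlpoly {..<n} e (\<lambda>_. 0) = e {}" by simp
    then show ?thesis using interior[of "\<lambda>_. 0"] by simp
  qed
  have T: "?T M j = mlpoly {..<n} (\<lambda>S. (1 - \<eta>) ^ card S * e S) (\<lambda>i. bit_sign j (M i))"
    if M: "M \<in> set_pmf ?P" and "j < k" for M j
  proof -
    have bits: "M i j \<in> {0, 1}" if "i < n" for i
      using columns_mem_cube[OF sub M that \<open>j < k\<close>] .
    have "?T M j = mlpoly {..<n} e (\<lambda>i. 1 - 2 * noisy_row \<eta> j M i)"
      by (rule avg) (rule noisy_row_mem(1)[of M _ j, OF bits \<eta>])
    also have "\<dots> = mlpoly {..<n} e (\<lambda>i. (1 - \<eta>) * bit_sign j (M i))"
    proof (rule mlpoly_cong)
      fix i assume "i \<in> {..<n}"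
      then have "M i j = 0 \<or> M i j = 1" using bits by auto
      then show "1 - 2 * noisy_row \<eta> j M i = (1 - \<eta>) * bit_sign j (M i)"
        by (auto simp: noisy_row_def bit_sign_def algebra_simps)
    qed simp
    finally show ?thesis by (simp add: mlpoly_scale)
  qed
  have main: "\<bar>measure_pmf.expectation ?P (\<lambda>M. \<Prod>j\<in>S. ?T M j) - e {} ^ card S\<bar> \<le> 2 ^ k * B"
    if S: "S \<in> Pow {..<k}" for S
  proof -
    interpret pairwise_signs \<mu> bit_sign S
      using pairwise_signs_bit_sign[OF \<mu> \<open>k \<ge> 2\<close>] S by simp
    have "measure_pmf.expectation ?P (\<lambda>M. \<Prod>j\<in>S. ?T M j) =
        measure_pmf.expectation (columns {..<n})
          (\<lambda>M. \<Prod>j\<in>S. row_poly {..<n} (\<lambda>S. (1 - \<eta>) ^ card S * e S) j M)"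
      unfolding columns_def
      by (intro expectation_cong prod.cong refl T) (use S in auto)
    moreover have "\<bar>measure_pmf.expectation (columns {..<n})
          (\<lambda>M. \<Prod>j\<in>S. row_poly {..<n} (\<lambda>S. (1 - \<eta>) ^ card S * e S) j M) - e {} ^ card S\<bar>
        \<le> 2 ^ card S * (sqrt (\<tau> + (1 - \<eta>) ^ d) / (1 - (1 - \<eta>)))"
    proof (rule expectation_prod_quasirandom)
      show "\<bar>mlpoly {..<n} e z\<bar> \<le> 1" if "\<And>i. \<bar>z i\<bar> \<le> 1" for z
        using interior[of z] that by simp
    qed (use \<eta> \<open>\<tau> > 0\<close> low in auto)
    moreover have "2 ^ card S * B \<le> 2 ^ k * B"
      using S \<open>B \<ge> 0\<close> card_mono[of "{..<k}" S] by (intro mult_right_mono power_increasing) auto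
    ultimately show ?thesis by (simp add: B_def)
  qed
  have "accept_prob (noisy_test k f \<mu> \<eta> n F) =
      measure_pmf.expectation ?P (\<lambda>M. mlpoly {..<k} c (?T M))"
    by (rule accept_prob_noisy_test[OF fin F c range])
  also have "\<dots> = (\<Sum>S\<in>Pow {..<k}. c S * measure_pmf.expectation ?P (\<lambda>M. \<Prod>j\<in>S. ?T M j))"
    unfolding mlpoly_def using finP
    by (simp add: Bochner_Integration.integral_sum integrable_measure_pmf_finite)
  also have "\<dots> \<le> (\<Sum>S\<in>Pow {..<k}. c S * e {} ^ card S + \<bar>c S\<bar> * (2 ^ k * B))"
  proof (rule sum_mono)
    fix S assume "S \<in> Pow {..<k}"
    let ?x = "measure_pmf.expectation ?P (\<lambda>M. \<Prod>j\<in>S. ?T M j)"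
    have "c S * (?x - e {} ^ card S) \<le> \<bar>c S\<bar> * \<bar>?x - e {} ^ card S\<bar>"
      unfolding abs_mult[symmetric] by (rule abs_ge_self)
    also have "\<dots> \<le> \<bar>c S\<bar> * (2 ^ k * B)"
      by (rule mult_left_mono[OF main[OF \<open>S \<in> Pow {..<k}\<close>]]) simp
    finally show "c S * ?x \<le> c S * e {} ^ card S + \<bar>c S\<bar> * (2 ^ k * B)"
      unfolding right_diff_distrib by linarith
  qed
  also have "\<dots> = s_biased k f (e {}) + (\<Sum>S\<in>Pow {..<k}. \<bar>c S\<bar>) * (2 ^ k * B)"
    using s[OF p] by (simp add: mlpoly_def sum.distrib sum_distrib_right)
  also have "s_biased k f (e {}) \<le> s_val k f"
    using p by (rule s_biased_le_s_val)
  finally show ?thesis by (simp add: B_def)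
qed

text \<open>
  For one query, balanced pairwise independence is void and the query need not be uniform;
  soundness then holds because \<open>f\<close> is affine.
\<close>

lemma noisy_test_sound_one:
  assumes "set_pmf \<mu> \<subseteq> cube 1" and F: "F \<in> cube n \<rightarrow> {0..1}"
    and c: "\<And>y. y \<in> solid_cube 1 \<Longrightarrow> f y = mlpoly {..<1} c y"
    and s: "\<And>p. p \<in> {0..1} \<Longrightarrow> s_biased 1 f p = mlpoly {..<1} c (\<lambda>_. p)"
    and range: "\<And>y. y \<in> solid_cube 1 \<Longrightarrow> f y \<in> {0..1}"
  shows "accept_prob (noisy_test 1 f \<mu> \<eta> n F) \<le> s_val 1 f"
proof -
  let ?P = "Pi_pmf {..<n} undefined (\<lambda>_. \<mu>)"
  let ?T = "\<lambda>M j. measure_pmf.expectation (product_bernoulli n (noisy_row \<eta> j M)) F"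
  have fin: "finite (set_pmf \<mu>)"
    using assms(1) finite_cube by (rule finite_subset)
  then have finP: "finite (set_pmf ?P)"
    by (intro finite_set_Pi_pmf) auto
  have "accept_prob (noisy_test 1 f \<mu> \<eta> n F) =
      measure_pmf.expectation ?P (\<lambda>M. mlpoly {..<1} c (?T M))"
    by (rule accept_prob_noisy_test[OF fin F c range])
  also have "\<dots> \<le> measure_pmf.expectation ?P (\<lambda>_. s_val 1 f)"
  proof (rule expectation_mono[OF finP])
    fix M
    have p: "?T M 0 \<in> {0..1}"
      using F by (rule expectation_product_bernoulli_mem)
    have "mlpoly {..<1} c (?T M) = mlpoly {..<1} c (\<lambda>_. ?T M 0)"
      by (rule mlpoly_cong) auto
    also have "\<dots> = s_biased 1 f (?T M 0)"
      using s[OF p] by simp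
    also have "\<dots> \<le> s_val 1 f"
      using p by (rule s_biased_le_s_val)
    finally show "mlpoly {..<1} c (?T M) \<le> s_val 1 f" .
  qed
  finally show ?thesis by simp
qed

theorem theorem5:
  fixes k :: nat and \<mu> :: "point pmf" and G f :: "point \<Rightarrow> real" and \<epsilon> :: real
  assumes "k \<ge> 1"
    and "balanced_pairwise_independent k \<mu>"
    and "G \<in> cube k \<rightarrow> {0..1}"
    and "multilinear_extension k G f"
    and "\<epsilon> > 0"
  shows "\<exists>(d :: nat) (\<tau> :: real). d > 0 \<and> \<tau> > 0 \<and>
    (\<exists>A :: nat \<Rightarrow> (point \<Rightarrow> real) \<Rightarrow> bool pmf. \<forall>n.
       is_query_test k f n (A n) \<and>
       (\<forall>F \<in> cube n \<rightarrow> {0..1}.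
          (dictator n F \<longrightarrow> accept_prob (A n F) \<ge> c_val \<mu> f - \<epsilon>) \<and>
          (quasirandom n d \<tau> F \<longrightarrow> accept_prob (A n F) \<le> s_val k f + \<epsilon>)))"
proof -
  obtain c where f: "\<forall>y\<in>solid_cube k. f y = mlpoly {..<k} c y \<and> f y \<in> {0..1}"
    and s: "\<forall>p\<in>{0..1}. s_biased k f p = mlpoly {..<k} c (\<lambda>_. p)"
    using multilinear_extension_mlpoly[OF assms(4,3)] by (elim exE conjE)
  note c = f[THEN bspec, THEN conjunct1] and range = f[THEN bspec, THEN conjunct2]
    and s = s[THEN bspec]
  have sub: "set_pmf \<mu> \<subseteq> cube k"
    using assms(2) by (simp add: balanced_pairwise_independent_def)
  define C where "C = (\<Sum>S\<in>Pow {..<k}. \<bar>c S\<bar>)"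
  have C: "C \<ge> 0" unfolding C_def by (intro sum_nonneg) auto
  define \<eta> where "\<eta> = min (1 / 2) (\<epsilon> / (k * (C + 1)))"
  have "0 < \<epsilon> / (k * (C + 1))"
    using assms(1,5) C by simp
  then have "0 < \<eta>"
    by (simp add: \<eta>_def)
  moreover have "\<eta> \<le> 1 / 2"
    unfolding \<eta>_def by (rule min.cobounded1)
  ultimately have \<eta>: "0 < \<eta>" "\<eta> \<le> 1 / 2" by auto
  have complete: "C * (k * (\<eta> / 2)) \<le> \<epsilon>"
  proof -
    have "C * (k * (\<eta> / 2)) = (k * \<eta>) * (C / 2)" by simp
    also have "\<dots> \<le> (k * \<eta>) * (C + 1)"
      using C \<eta>(1) by (intro mult_left_mono) simp_all
    also have "\<dots> = \<eta> * (k * (C + 1))" by simp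
    also have "\<dots> \<le> \<epsilon>"
    proof -
      have "\<eta> \<le> \<epsilon> / (k * (C + 1))"
        unfolding \<eta>_def by (rule min.cobounded2)
      then show ?thesis
        using assms(1) C by (subst (asm) pos_le_divide_eq) simp_all
    qed
    finally show ?thesis .
  qed
  define \<delta> where "\<delta> = \<epsilon> * \<eta> / ((C + 1) * 2 ^ k)"
  have \<delta>: "\<delta> > 0" using assms(5) \<eta>(1) C by (simp add: \<delta>_def)
  define \<tau> where "\<tau> = \<delta>\<^sup>2 / 2"
  have \<tau>: "\<tau> > 0" using \<delta> by (simp add: \<tau>_def)
  have "1 - \<eta> < 1" using \<eta>(1) by simp
  from real_arch_pow_inv[OF \<tau> this] obtain m where m: "(1 - \<eta>) ^ m < \<tau>" ..
  define d where "d = Suc m"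
  have "(1 - \<eta>) ^ d \<le> (1 - \<eta>) ^ m"
    unfolding d_def using \<eta> by (intro power_decreasing) auto
  with m have "sqrt (\<tau> + (1 - \<eta>) ^ d) \<le> sqrt (\<delta>\<^sup>2)"
    by (intro real_sqrt_le_mono) (simp add: \<tau>_def)
  then have "sqrt (\<tau> + (1 - \<eta>) ^ d) \<le> \<delta>" using \<delta> by simp
  then have "C * (2 ^ k * (sqrt (\<tau> + (1 - \<eta>) ^ d) / \<eta>)) \<le> C * (2 ^ k * (\<delta> / \<eta>))"
    using C \<eta>(1) by (intro mult_left_mono divide_right_mono) simp_all
  also have "\<dots> = \<epsilon> * (C / (C + 1))"
    using C \<eta>(1) by (simp add: \<delta>_def)
  also have "\<dots> \<le> \<epsilon>"
    using C assms(5) by (intro mult_left_le) simp_all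
  finally have sound: "C * (2 ^ k * (sqrt (\<tau> + (1 - \<eta>) ^ d) / \<eta>)) \<le> \<epsilon>" .
  show ?thesis
  proof (intro exI[of _ d] exI[of _ \<tau>] exI[of _ "noisy_test k f \<mu> \<eta>"] conjI allI ballI impI)
    show "d > 0" "\<tau> > 0" using \<tau> by (auto simp: d_def)
    fix n
    show "is_query_test k f n (noisy_test k f \<mu> \<eta> n)"
      by (rule is_query_test_noisy_test)
    fix F :: "point \<Rightarrow> real"
    assume F: "F \<in> cube n \<rightarrow> {0..1}"
    show "accept_prob (noisy_test k f \<mu> \<eta> n F) \<ge> c_val \<mu> f - \<epsilon>" if "dictator n F"
      using noisy_test_complete[OF sub F c range \<eta> that] complete by (simp add: C_def)
    show "accept_prob (noisy_test k f \<mu> \<eta> n F) \<le> s_val k f + \<epsilon>" if q: "quasirandom n d \<tau> F"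
    proof (cases "k = 1")
      case True
      have "accept_prob (noisy_test k f \<mu> \<eta> n F) \<le> s_val k f"
        using noisy_test_sound_one[of \<mu> F n f c \<eta>] sub F c s range unfolding True by blast
      then show ?thesis using assms by simp
    next
      case False
      then have "k \<ge> 2" using assms by simp
      from noisy_test_sound[OF assms(2) this F c s range \<eta> \<tau> q] sound show ?thesis
        by (simp add: C_def)
    qed
  qed
qed

end
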